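(* Let $G$ be a graph of order $n(G)$ with $\chi(G)\geq 4$. Let $G'$ be the graph obtained from $G$ by attaching $\chi(G)-1$ new pendant vertices to each vertex of $G$, so that $G'$ has order $n(G')=n(G)\chi(G)$. Then $$sn(G'\circ K_1)=n(G)\chi(G)+n(G)\,[\chi(G)-1]=n(G')+sn(G').$$
   Context: All graphs are finite, undirected, simple and connected; the order of a graph is its number of vertices. $\chi(G)$ is the chromatic number. Sudoku number: let $\chi(G)=k$ and fix the set of $k$ colors $\{1,\dots,k\}$. For $S\subset V(G)$ let $C_0$ be a proper coloring of the induced subgraph $G[S]$ with colors from these $k$ colors (at most $k$ colors are used). $C_0$ is called extendable if it can be extended to a proper coloring of $G$ with these $k$ colors, and it is a Sudoku coloring of $G$ if this extension exists and is unique. The Sudoku number $sn(G)$ is the smallest $|S|$ such that $G[S]$ admits a Sudoku coloring. Corona product: $G\circ H$ is obtained from one copy of $G$ and $|V(G)|$ disjoint copies of $H$ by joining the $i$-th vertex of $G$ to every vertex of the $i$-th copy of $H$. *)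

theory Defs
  imports "Graph_Theory.Graph_Theory" "HOL-Library.FuncSet"
begin

text \<open>
  Graphs are the library's finite, loop-free, symmetric digraphs without parallel arcs:
  every undirected edge is represented by its two opposite arcs.
\<close>

text \<open>
  Colorings with the colors 1, ..., k. They are extensional functions on the vertex set, so that
  two colorings are equal iff they agree on all vertices; this matters for uniqueness below.
\<close>

definition proper_coloring :: "('a, 'b) pre_digraph \<Rightarrow> nat \<Rightarrow> ('a \<Rightarrow> nat) \<Rightarrow> bool" where
  "proper_coloring G k c \<longleftrightarrow>
     c \<in> verts G \<rightarrow>\<^sub>E {1..k} \<and> (\<forall>u v. u \<rightarrow>\<^bsub>G\<^esub> v \<longrightarrow> c u \<noteq> c v)"

definition chromatic_number :: "('a, 'b) pre_digraph \<Rightarrow> nat" where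
  "chromatic_number G = (LEAST k. \<exists>c. proper_coloring G k c)"

definition sudoku_coloring :: "('a, 'b) pre_digraph \<Rightarrow> 'a set \<Rightarrow> ('a \<Rightarrow> nat) \<Rightarrow> bool" where
  "sudoku_coloring G S C0 \<longleftrightarrow>
     proper_coloring (G \<restriction> S) (chromatic_number G) C0 \<and>
     (\<exists>!c. proper_coloring G (chromatic_number G) c \<and> (\<forall>v\<in>S. c v = C0 v))"

definition sudoku_number :: "('a, 'b) pre_digraph \<Rightarrow> nat" where
  "sudoku_number G = (LEAST m. \<exists>S C0. S \<subseteq> verts G \<and> card S = m \<and> sudoku_coloring G S C0)"

text \<open>
  In the next two definitions \<open>Inl v\<close> is the vertex \<open>v\<close> of \<open>G\<close>, and \<open>Inr (v, x)\<close> is the vertex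
  \<open>x\<close> of the copy of \<open>H\<close> belonging to \<open>v\<close>, respectively the \<open>x\<close>-th pendant vertex at \<open>v\<close>.
\<close>

definition corona ::
  "'a pair_pre_digraph \<Rightarrow> 'b pair_pre_digraph \<Rightarrow> ('a + 'a \<times> 'b) pair_pre_digraph" where
  "corona G H = \<lparr>
     pverts = Inl ` pverts G \<union> Inr ` (pverts G \<times> pverts H),
     parcs = {(Inl u, Inl v) | u v. (u, v) \<in> parcs G}
       \<union> {(Inr (v, x), Inr (v, y)) | v x y. v \<in> pverts G \<and> (x, y) \<in> parcs H}
       \<union> {(Inl v, Inr (v, x)) | v x. v \<in> pverts G \<and> x \<in> pverts H}
       \<union> {(Inr (v, x), Inl v) | v x. v \<in> pverts G \<and> x \<in> pverts H} \<rparr>"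

definition attach_pendants ::
  "'a pair_pre_digraph \<Rightarrow> nat \<Rightarrow> ('a + 'a \<times> nat) pair_pre_digraph" where
  "attach_pendants G m = \<lparr>
     pverts = Inl ` pverts G \<union> Inr ` (pverts G \<times> {..<m}),
     parcs = {(Inl u, Inl v) | u v. (u, v) \<in> parcs G}
       \<union> {(Inl v, Inr (v, i)) | v i. v \<in> pverts G \<and> i < m}
       \<union> {(Inr (v, i), Inl v) | v i. v \<in> pverts G \<and> i < m} \<rparr>"

end

(* A vertex outside S has to see all other chi - 1 colors, since otherwise it could be recolored in
   the unique extension. Hence S contains every vertex of degree at most chi - 2; in G' these are
   the pendant vertices, and in G' o K_1, as chi >= 4, the leaves (degree 1) together with the
   former pendant vertices (degree 2). Conversely, these vertices suffice: take a proper coloring c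
   of G and give the chi - 1 pendant vertices at v all the colors other than c v, so that the color
   of v is forced. *)

theory Submission
  imports Defs
begin

section \<open>Proper colorings and the chromatic number\<close>

lemma proper_coloring_arcD:
  "proper_coloring G k c \<Longrightarrow> u \<rightarrow>\<^bsub>G\<^esub> v \<Longrightarrow> c u \<noteq> c v"
  by (auto simp: proper_coloring_def)

lemma proper_coloring_range:
  "proper_coloring G k c \<Longrightarrow> v \<in> verts G \<Longrightarrow> c v \<in> {1..k}"
  by (auto simp: proper_coloring_def)

text \<open>Coloring pulled back along a graph homomorphism \<open>f\<close>. The
  \<open>restrict\<close> is there because colorings are extensional.\<close>

lemma (in wf_digraph) proper_coloring_comp:
  assumes "proper_coloring H k c"
    and "\<And>v. v \<in> verts G \<Longrightarrow> f v \<in> verts H"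
    and "\<And>u v. u \<rightarrow>\<^bsub>G\<^esub> v \<Longrightarrow> f u \<rightarrow>\<^bsub>H\<^esub> f v"
  shows "proper_coloring G k (restrict (c \<circ> f) (verts G))"
  using assms unfolding proper_coloring_def
  by (auto simp: adj_in_verts)

text \<open>Numbering the vertices gives pairwise distinct colors. This ensures that the
  \<open>LEAST\<close> in \<open>chromatic_number\<close> is attained.\<close>

lemma (in digraph) ex_proper_coloring: "\<exists>k c. proper_coloring G k c"
proof -
  obtain h where h: "bij_betw h (verts G) {1..card (verts G)}"
    using ex_bij_betw_nat_finite_1[OF finite_verts] bij_betw_inv by blast
  have "proper_coloring G (card (verts G)) (restrict h (verts G))"
    unfolding proper_coloring_def
  proof (intro conjI allI impI)
    show "restrict h (verts G) \<in> verts G \<rightarrow>\<^sub>E {1..card (verts G)}"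
      using h by (auto simp: bij_betw_def)
  next
    fix u v assume uv: "u \<rightarrow>\<^bsub>G\<^esub> v"
    then have "u \<in> verts G" "v \<in> verts G" "u \<noteq> v"
      using adj_not_same by (auto simp: adj_in_verts)
    then show "restrict h (verts G) u \<noteq> restrict h (verts G) v"
      using h by (auto simp: bij_betw_def inj_on_def)
  qed
  then show ?thesis by blast
qed

lemma (in digraph) ex_chromatic_coloring: "\<exists>c. proper_coloring G (chromatic_number G) c"
  unfolding chromatic_number_def using ex_proper_coloring by (rule LeastI_ex)

text \<open>A homomorphism \<open>f\<close> from \<open>G\<close> to \<open>H\<close> pulls every
  coloring of \<open>H\<close> back to \<open>G\<close>, so \<open>H\<close> cannot need fewer
  colors; \<open>c\<close> shows that it needs no more. Below, \<open>f\<close> is the embedding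
  \<open>Inl\<close> of \<open>G\<close> into a larger graph.\<close>

lemma (in wf_digraph) chromatic_number_eqI:
  assumes "\<And>v. v \<in> verts G \<Longrightarrow> f v \<in> verts H"
    and "\<And>u v. u \<rightarrow>\<^bsub>G\<^esub> v \<Longrightarrow> f u \<rightarrow>\<^bsub>H\<^esub> f v"
    and "proper_coloring H (chromatic_number G) c"
  shows "chromatic_number H = chromatic_number G"
  unfolding chromatic_number_def[of H]
proof (rule Least_equality)
  show "\<exists>c. proper_coloring H (chromatic_number G) c" using assms(3) by blast
next
  fix k assume "\<exists>c. proper_coloring H k c"
  then have "\<exists>c. proper_coloring G k c"
    using proper_coloring_comp assms(1,2) by blast
  then show "chromatic_number G \<le> k"
    unfolding chromatic_number_def by (rule Least_le)
qed

section \<open>Sudoku colorings and vertices of low degree\<close>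

lemma (in graph) sudoku_coloring_low_degree:
  assumes "sudoku_coloring G S C0"
    and v: "v \<in> verts G" and deg: "card {u. v \<rightarrow> u} + 2 \<le> chromatic_number G"
  shows "v \<in> S"
proof (rule ccontr)
  assume "v \<notin> S"
  let ?k = "chromatic_number G"
  from assms(1) obtain c where c: "proper_coloring G ?k c" "\<forall>w\<in>S. c w = C0 w"
    and unique: "\<And>c'. proper_coloring G ?k c' \<Longrightarrow> \<forall>w\<in>S. c' w = C0 w \<Longrightarrow> c' = c"
    unfolding sudoku_coloring_def by metis
  have fin: "finite {u. v \<rightarrow> u}"
    by (rule finite_subset[OF _ finite_verts]) (auto simp: adj_in_verts)
  \<comment> \<open>The color of \<open>v\<close> and those of its neighbors are at most degree plus
    one many, hence fewer than \<open>?k\<close>: some color \<open>x\<close> is free, and moving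
    \<open>v\<close> to \<open>x\<close> yields a second extension.\<close>
  have "card (insert (c v) (c ` {u. v \<rightarrow> u})) \<le> Suc (card {u. v \<rightarrow> u})"
    using card_image_le[OF fin, of c] fin by (simp add: card_insert_if)
  also have "\<dots> < card {1..?k}" using deg by simp
  finally have "\<not> {1..?k} \<subseteq> insert (c v) (c ` {u. v \<rightarrow> u})"
    using fin card_mono[of "insert (c v) (c ` {u. v \<rightarrow> u})" "{1..?k}"] by auto
  then obtain x where x: "x \<in> {1..?k}" "x \<noteq> c v" "\<And>u. v \<rightarrow> u \<Longrightarrow> c u \<noteq> x"
    by blast
  have "proper_coloring G ?k (c(v := x))"
    unfolding proper_coloring_def
  proof (intro conjI allI impI)
    show "c(v := x) \<in> verts G \<rightarrow>\<^sub>E {1..?k}"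
      using c(1) x(1) v unfolding proper_coloring_def by (auto simp: PiE_iff extensional_def)
  next
    fix a b assume ab: "a \<rightarrow> b"
    \<comment> \<open>\<open>x(3)\<close> speaks of arcs leaving \<open>v\<close> only; the reversed
      arc covers the case that \<open>v\<close> is the head \<open>b\<close>.\<close>
    then have "b \<rightarrow> a" by (rule graph_symmetric)
    with ab show "(c(v := x)) a \<noteq> (c(v := x)) b"
      using x(3)[of a] x(3)[of b] proper_coloring_arcD[OF c(1) ab] adj_not_same[of v]
      by (auto split: if_splits)
  qed
  with unique[of "c(v := x)"] c(2) \<open>v \<notin> S\<close> have "c(v := x) = c" by auto
  with x(2) show False by (metis fun_upd_same)
qed

text \<open>If an extension \<open>d\<close> had \<open>d v\<close> different from
  \<open>c v\<close> outside \<open>S\<close>, then by \<open>dominated\<close> the color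
  \<open>d v\<close> would already sit on a neighbor of \<open>v\<close> in \<open>S\<close>, where
  \<open>d\<close> and \<open>c\<close> agree.\<close>

lemma (in graph) sudoku_coloring_restrict:
  assumes c: "proper_coloring G (chromatic_number G) c" and S: "S \<subseteq> verts G"
    and dominated: "\<And>v x. v \<in> verts G - S \<Longrightarrow> x \<in> {1..chromatic_number G} - {c v}
      \<Longrightarrow> \<exists>u\<in>S. v \<rightarrow> u \<and> c u = x"
  shows "sudoku_coloring G S (restrict c S)"
  unfolding sudoku_coloring_def
proof (intro conjI ex1I)
  show "proper_coloring (G \<restriction> S) (chromatic_number G) (restrict c S)"
    using c S unfolding proper_coloring_def
    by (fastforce simp: arcs_ends_conv PiE_iff)
next
  show "proper_coloring G (chromatic_number G) c" by (fact c)
next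
  show "\<forall>v\<in>S. c v = restrict c S v" by simp
next
  fix d assume "proper_coloring G (chromatic_number G) d \<and> (\<forall>v\<in>S. d v = restrict c S v)"
  then have d: "proper_coloring G (chromatic_number G) d" "\<And>v. v \<in> S \<Longrightarrow> d v = c v" by auto
  show "d = c"
  proof (rule PiE_ext)
    show "d \<in> verts G \<rightarrow>\<^sub>E {1..chromatic_number G}"
      "c \<in> verts G \<rightarrow>\<^sub>E {1..chromatic_number G}"
      using c d(1) by (auto simp: proper_coloring_def)
  next
    fix v assume v: "v \<in> verts G"
    show "d v = c v"
    proof (rule ccontr)
      assume "d v \<noteq> c v"
      with v d(2) proper_coloring_range[OF d(1) v] dominated[of v "d v"]
      obtain u where "u \<in> S" "v \<rightarrow> u" "c u = d v" by auto
      with d(2) proper_coloring_arcD[OF d(1)] show False by metis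
    qed
  qed
qed

text \<open>The second assumption puts \<open>D\<close> inside every set carrying a Sudoku coloring;
  the last two make \<open>D\<close> itself such a set. So \<open>D\<close> is optimal.\<close>

lemma (in graph) sudoku_number_eq_card_low_degree:
  assumes "D \<subseteq> verts G"
    and "\<And>v. v \<in> D \<Longrightarrow> card {u. v \<rightarrow> u} + 2 \<le> chromatic_number G"
    and "proper_coloring G (chromatic_number G) c"
    and "\<And>v x. v \<in> verts G - D \<Longrightarrow> x \<in> {1..chromatic_number G} - {c v}
      \<Longrightarrow> \<exists>u\<in>D. v \<rightarrow> u \<and> c u = x"
  shows "sudoku_number G = card D"
  unfolding sudoku_number_def
proof (rule Least_equality)
  show "\<exists>S C0. S \<subseteq> verts G \<and> card S = card D \<and> sudoku_coloring G S C0"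
    using sudoku_coloring_restrict[OF assms(3,1,4)] assms(1) by blast
next
  fix m assume "\<exists>S C0. S \<subseteq> verts G \<and> card S = m \<and> sudoku_coloring G S C0"
  then obtain S C0 where S: "S \<subseteq> verts G" "card S = m" "sudoku_coloring G S C0" by blast
  have "D \<subseteq> S" using sudoku_coloring_low_degree[OF S(3)] assms(1,2) by blast
  then show "card D \<le> m" using S(1,2) card_mono finite_subset finite_verts by metis
qed

section \<open>The two constructions as graphs, and their chromatic numbers\<close>

lemma dominates_with_proj: "u \<rightarrow>\<^bsub>with_proj G\<^esub> v \<longleftrightarrow> (u, v) \<in> parcs G"
  by (auto simp: arcs_ends_conv)

lemma pair_graphI:
  assumes "finite (pverts G)" "\<And>u v. (u, v) \<in> parcs G \<Longrightarrow> u \<in> pverts G"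
    "\<And>u v. (u, v) \<in> parcs G \<Longrightarrow> (v, u) \<in> parcs G" "\<And>v. (v, v) \<notin> parcs G"
  shows "pair_graph G"
proof -
  have "parcs G \<subseteq> pverts G \<times> pverts G" using assms(2,3) by auto
  then have "finite (parcs G)" using assms(1) by (simp add: finite_subset)
  then show ?thesis
    using assms
    by unfold_locales (force simp: symmetric_def arcs_ends_conv intro: symI)+
qed

lemma pair_graph_attach_pendants:
  assumes "pair_graph G"
  shows "pair_graph (attach_pendants G m)"
proof -
  interpret pair_graph G by fact
  show ?thesis
    by (rule pair_graphI)
      (auto simp: attach_pendants_def in_arcsD1 in_arcsD2 dest: no_loops' intro: arcs_symmetric)
qed

lemma pair_graph_corona:
  assumes "pair_graph G" "pair_graph H"
  shows "pair_graph (corona G H)"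
proof -
  interpret G: pair_graph G by fact
  interpret H: pair_graph H by fact
  show ?thesis
    by (rule pair_graphI)
      (auto simp: corona_def G.in_arcsD1 G.in_arcsD2 H.in_arcsD1 H.in_arcsD2
         dest: G.no_loops' H.no_loops' intro: G.arcs_symmetric H.arcs_symmetric)
qed

text \<open>The pendant vertices at a vertex of color \<open>a\<close> receive the colors different from \<open>a\<close> in
  increasing order.\<close>

definition pendant_coloring :: "('a \<Rightarrow> nat) \<Rightarrow> 'a + 'a \<times> nat \<Rightarrow> nat" where
  "pendant_coloring c = case_sum c (\<lambda>(v, i). if Suc i < c v then Suc i else Suc (Suc i))"

lemma pendant_coloring_simps [simp]:
  "pendant_coloring c (Inl v) = c v"
  "pendant_coloring c (Inr (v, i)) = (if Suc i < c v then Suc i else Suc (Suc i))"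
  by (simp_all add: pendant_coloring_def)

text \<open>Indices start at 0 and colors at 1, so color \<open>x\<close> sits at index
  \<open>x - 1\<close> below the gap \<open>c v\<close> and at index \<open>x - 2\<close> above
  it.\<close>

lemma pendant_coloring_surj:
  assumes "x \<in> {1..k} - {c v}" "c v \<in> {1..k}"
  shows "\<exists>i<k - 1. pendant_coloring c (Inr (v, i)) = x"
proof (cases "x < c v")
  case True
  with assms show ?thesis by (intro exI[of _ "x - 1"]) auto
next
  case False
  with assms show ?thesis by (intro exI[of _ "x - 2"]) auto
qed

text \<open>The skipped color \<open>c v\<close> separates each pendant vertex from
  \<open>v\<close>, and the largest index \<open>k - 2\<close> receives at most the color
  \<open>k\<close>.\<close>

lemma proper_coloring_attach_pendants:
  assumes G: "pair_graph G" and c: "proper_coloring (with_proj G) k c"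
  shows "proper_coloring (with_proj (attach_pendants G (k - 1))) k
    (restrict (pendant_coloring c) (pverts (attach_pendants G (k - 1))))"
proof -
  interpret pair_graph G by fact
  show ?thesis
    using c proper_coloring_range[OF c]
    unfolding proper_coloring_def dominates_with_proj
    by (auto simp: attach_pendants_def in_arcsD1 in_arcsD2 split: if_splits)
qed

lemma chromatic_number_attach_pendants:
  assumes G: "pair_graph G"
  shows "chromatic_number (with_proj (attach_pendants G (chromatic_number (with_proj G) - 1)))
    = chromatic_number (with_proj G)"
proof -
  interpret pair_graph G by fact
  obtain c where "proper_coloring (with_proj G) (chromatic_number (with_proj G)) c"
    using ex_chromatic_coloring by blast
  from proper_coloring_attach_pendants[OF G this] show ?thesis
    \<comment> \<open>The rotation moves the coloring premise to the front, where the chained fact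
      discharges it; the conditions on the embedding \<open>Inl\<close> remain.\<close>
    by (rule chromatic_number_eqI[of Inl, rotated 2])
      (auto simp: dominates_with_proj, auto simp: attach_pendants_def)
qed

text \<open>All vertices of one copy share a color, which suits copies without arcs; two colors are
  enough to avoid \<open>c v\<close>.\<close>

definition leaf_coloring :: "('a \<Rightarrow> nat) \<Rightarrow> 'a + 'a \<times> 'b \<Rightarrow> nat" where
  "leaf_coloring c = case_sum c (\<lambda>(v, x). if c v = 1 then 2 else 1)"

lemma leaf_coloring_simps [simp]:
  "leaf_coloring c (Inl v) = c v"
  "leaf_coloring c (Inr (v, x)) = (if c v = 1 then 2 else 1)"
  by (simp_all add: leaf_coloring_def)

lemma proper_coloring_corona:
  assumes G: "pair_graph G" and c: "proper_coloring (with_proj G) k c"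
    and "2 \<le> k" and "parcs H = {}"
  shows "proper_coloring (with_proj (corona G H)) k
    (restrict (leaf_coloring c) (pverts (corona G H)))"
proof -
  interpret pair_graph G by fact
  show ?thesis
    using c proper_coloring_range[OF c] assms(3,4)
    unfolding proper_coloring_def dominates_with_proj
    by (auto simp: corona_def in_arcsD1 in_arcsD2 split: if_splits)
qed

lemma chromatic_number_corona:
  assumes G: "pair_graph G" and "2 \<le> chromatic_number (with_proj G)" and "parcs H = {}"
  shows "chromatic_number (with_proj (corona G H)) = chromatic_number (with_proj G)"
proof -
  interpret pair_graph G by fact
  obtain c where "proper_coloring (with_proj G) (chromatic_number (with_proj G)) c"
    using ex_chromatic_coloring by blast
  from proper_coloring_corona[OF G this assms(2,3)] show ?thesis
    by (rule chromatic_number_eqI[of Inl, rotated 2])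
      (auto simp: dominates_with_proj, auto simp: corona_def)
qed

section \<open>Sudoku numbers of the two constructions\<close>

lemma sudoku_number_attach_pendants:
  fixes G :: "'a pair_pre_digraph"
  assumes G: "pair_graph G" and k: "k = chromatic_number (with_proj G)" "3 \<le> k"
  shows "sudoku_number (with_proj (attach_pendants G (k - 1))) = card (pverts G) * (k - 1)"
proof -
  let ?G' = "attach_pendants G (k - 1)" and ?D = "Inr ` (pverts G \<times> {..<k - 1}) :: ('a + 'a \<times> nat) set"
  interpret G: pair_graph G by fact
  interpret G': pair_graph ?G' using G by (rule pair_graph_attach_pendants)
  have chi: "chromatic_number (with_proj ?G') = k"
    using chromatic_number_attach_pendants[OF G] k(1) by simp
  obtain c where c: "proper_coloring (with_proj G) k c"
    using G.ex_chromatic_coloring k(1) by blast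
  have "sudoku_number (with_proj ?G') = card ?D"
  proof (rule graph.sudoku_number_eq_card_low_degree[OF G'.pair_graphD_graph], unfold chi)
    show "?D \<subseteq> verts (with_proj ?G')" by (auto simp: attach_pendants_def)
    show "proper_coloring (with_proj ?G') k (restrict (pendant_coloring c) (pverts ?G'))"
      using G c by (rule proper_coloring_attach_pendants)
  next
    fix w assume "w \<in> ?D"
    then obtain v i where w: "w = Inr (v, i)" by auto
    \<comment> \<open>A pendant vertex has degree at most 1, which is at most \<open>k - 2\<close>
      because \<open>k\<close> is at least 3.\<close>
    have "{u. w \<rightarrow>\<^bsub>with_proj ?G'\<^esub> u} \<subseteq> {Inl v}"
      unfolding dominates_with_proj by (auto simp: w attach_pendants_def)
    from card_mono[OF _ this] show "card {u. w \<rightarrow>\<^bsub>with_proj ?G'\<^esub> u} + 2 \<le> k"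
      using k(2) by simp
  next
    fix w x assume w: "w \<in> verts (with_proj ?G') - ?D"
      and x: "x \<in> {1..k} - {restrict (pendant_coloring c) (pverts ?G') w}"
    from w obtain v where v: "w = Inl v" "v \<in> pverts G" by (auto simp: attach_pendants_def)
    with x w obtain i where "i < k - 1" "pendant_coloring c (Inr (v, i)) = x"
      using pendant_coloring_surj[of x k c v] proper_coloring_range[OF c, of v] by auto
    then show "\<exists>u\<in>?D. w \<rightarrow>\<^bsub>with_proj ?G'\<^esub> u
        \<and> restrict (pendant_coloring c) (pverts ?G') u = x"
      unfolding dominates_with_proj using v
      by (intro bexI[of _ "Inr (v, i)"]) (auto simp: attach_pendants_def simp del: pendant_coloring_simps)
  qed
  also have "\<dots> = card (pverts G) * (k - 1)"
    by (simp add: card_image card_cartesian_product)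
  finally show ?thesis .
qed

lemma sudoku_number_corona_attach_pendants:
  fixes G :: "'a pair_pre_digraph" and H :: "'b pair_pre_digraph"
  assumes G: "pair_graph G" and k: "k = chromatic_number (with_proj G)" "4 \<le> k"
    and H: "pverts H = {z}" "parcs H = {}"
  shows "sudoku_number (with_proj (corona (attach_pendants G (k - 1)) H))
    = card (pverts (attach_pendants G (k - 1))) + card (pverts G) * (k - 1)"
proof -
  let ?G' = "attach_pendants G (k - 1)"
  let ?K = "corona ?G' H"
  let ?P = "Inl ` Inr ` (pverts G \<times> {..<k - 1}) :: (('a + 'a \<times> nat) + ('a + 'a \<times> nat) \<times> 'b) set"
    and ?L = "Inr ` (pverts ?G' \<times> {z}) :: (('a + 'a \<times> nat) + ('a + 'a \<times> nat) \<times> 'b) set"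
  interpret G: pair_graph G by fact
  have G': "pair_graph ?G'" using G by (rule pair_graph_attach_pendants)
  then interpret G': pair_graph ?G' .
  have "pair_graph H" by (rule pair_graphI) (auto simp: H)
  with G' interpret K: pair_graph ?K by (rule pair_graph_corona)
  have "chromatic_number (with_proj ?G') = k"
    using chromatic_number_attach_pendants[OF G] k(1) by simp
  then have chi: "chromatic_number (with_proj ?K) = k"
    using chromatic_number_corona[OF G' _ H(2)] k(2) by simp
  obtain c where c: "proper_coloring (with_proj G) k c"
    using G.ex_chromatic_coloring k(1) by blast
  \<comment> \<open>Color \<open>G\<close> by \<open>c\<close>, then the pendant vertices, then the
    leaves of the corona.\<close>
  let ?c = "restrict (leaf_coloring (restrict (pendant_coloring c) (pverts ?G'))) (pverts ?K)"
  have "sudoku_number (with_proj ?K) = card (?L \<union> ?P)"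
  proof (rule graph.sudoku_number_eq_card_low_degree[OF K.pair_graphD_graph], unfold chi)
    show "?L \<union> ?P \<subseteq> verts (with_proj ?K)" by (auto simp: corona_def attach_pendants_def H)
    show "proper_coloring (with_proj ?K) k ?c"
      using G' proper_coloring_attach_pendants[OF G c] k(2) H(2)
      by (intro proper_coloring_corona) auto
  next
    fix w assume "w \<in> ?L \<union> ?P"
    then show "card {u. w \<rightarrow>\<^bsub>with_proj ?K\<^esub> u} + 2 \<le> k"
    proof
      assume "w \<in> ?L"
      then obtain v where w: "w = Inr (v, z)" by auto
      have "{u. w \<rightarrow>\<^bsub>with_proj ?K\<^esub> u} \<subseteq> {Inl v}"
        unfolding dominates_with_proj by (auto simp: w corona_def H)
      from card_mono[OF _ this] show ?thesis using k(2) by simp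
    next
      assume "w \<in> ?P"
      then obtain v i where w: "w = Inl (Inr (v, i))" by auto
      \<comment> \<open>A former pendant vertex is adjacent to its vertex of \<open>G\<close> and to
        its own new leaf only. Degree 2 is where \<open>k\<close> must be at least 4.\<close>
      have "{u. w \<rightarrow>\<^bsub>with_proj ?K\<^esub> u} \<subseteq> {Inl (Inl v), Inr (Inr (v, i), z)}"
        unfolding dominates_with_proj by (auto simp: w corona_def attach_pendants_def H)
      from card_mono[OF _ this] show ?thesis using k(2) by simp
    qed
  next
    fix w x assume w: "w \<in> verts (with_proj ?K) - (?L \<union> ?P)" and x: "x \<in> {1..k} - {?c w}"
    from w obtain v where v: "w = Inl (Inl v)" "v \<in> pverts G"
      by (auto simp: corona_def attach_pendants_def H)
    then have "?c w = c v" by (auto simp: corona_def attach_pendants_def)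
    with v x obtain i where "i < k - 1" "pendant_coloring c (Inr (v, i)) = x"
      using pendant_coloring_surj[of x k c v] proper_coloring_range[OF c, of v] by auto
    then show "\<exists>u\<in>?L \<union> ?P. w \<rightarrow>\<^bsub>with_proj ?K\<^esub> u \<and> ?c u = x"
      unfolding dominates_with_proj using v
      \<comment> \<open>The witness lies in \<open>?P\<close>: the former pendant vertices alone
        show every color other than \<open>c v\<close> to the vertex \<open>v\<close>.\<close>
      by (intro bexI[of _ "Inl (Inr (v, i))"])
        (auto simp: corona_def attach_pendants_def simp del: pendant_coloring_simps)
  qed
  also have "\<dots> = card ?L + card ?P"
    by (rule card_Un_disjoint)
      (auto intro!: finite_imageI finite_cartesian_product
        G'.pair_finite_verts[unfolded One_nat_def])
  also have "\<dots> = card (pverts ?G') + card (pverts G) * (k - 1)"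
    by (simp add: card_image inj_on_def card_cartesian_product)
  finally show ?thesis .
qed

text \<open>Each vertex of \<open>G\<close> contributes itself and its \<open>m\<close> pendant
  vertices.\<close>

lemma card_attach_pendants:
  assumes "finite (pverts G)"
  shows "card (pverts (attach_pendants G m)) = card (pverts G) * Suc m"
proof -
  have "pverts (attach_pendants G m) = pverts G <+> pverts G \<times> {..<m}"
    by (auto simp: attach_pendants_def)
  then show ?thesis using assms by (simp add: card_Plus card_cartesian_product)
qed

theorem mainTheorem2:
  fixes G :: "'a pair_pre_digraph" and K1 :: "'b pair_pre_digraph"
    and G' :: "('a + 'a \<times> nat) pair_pre_digraph"
  assumes "pair_graph G" and "Digraph_Component.connected (with_proj G)"
    and "chromatic_number (with_proj G) \<ge> 4"
    and "G' = attach_pendants G (chromatic_number (with_proj G) - 1)"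
    and "K\<^bsub>1\<^esub> (with_proj K1)"
  shows "card (pverts G') = card (pverts G) * chromatic_number (with_proj G)
    \<and> sudoku_number (with_proj (corona G' K1)) =
           card (pverts G) * chromatic_number (with_proj G)
           + card (pverts G) * (chromatic_number (with_proj G) - 1)
    \<and> card (pverts G) * chromatic_number (with_proj G)
           + card (pverts G) * (chromatic_number (with_proj G) - 1)
         = card (pverts G') + sudoku_number (with_proj G')"
proof -
  interpret pair_graph G by fact
  \<comment> \<open>The complete graph on one vertex \<open>z\<close> has no arcs, as arcs join
    distinct vertices.\<close>
  obtain z where z: "pverts K1 = {z}" "parcs K1 = {}"
    using assms(5) unfolding complete_digraph_pair_def by (auto simp: card_1_singleton_iff)
  have card: "card (pverts G') = card (pverts G) * chromatic_number (with_proj G)"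
    unfolding assms(4) card_attach_pendants[OF pair_finite_verts] using assms(3) by simp
  moreover have "sudoku_number (with_proj G')
      = card (pverts G) * (chromatic_number (with_proj G) - 1)"
    using sudoku_number_attach_pendants[OF assms(1) refl] assms(3,4) by simp
  moreover have "sudoku_number (with_proj (corona G' K1))
      = card (pverts G') + card (pverts G) * (chromatic_number (with_proj G) - 1)"
    using sudoku_number_corona_attach_pendants[OF assms(1) refl assms(3) z] assms(4) by simp
  ultimately show ?thesis by simp
qed

end
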